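(* Consider no-slip billiards in wedge domains for a disc with uniform mass distribution. For any positive even integer $n$ there exists a wedge domain for which the no-slip billiard has period-$n$ orbits. More specifically, all bounded orbits of the no-slip billiard in a wedge domain with corner angle $2\phi_{p,q}$, where $\phi_{p,q}$ satisfies $$\cos\phi_{p,q}=\frac{\sqrt3}{2}\sqrt{1-\sqrt{\frac{1+\cos(2\pi p/q)}{2}}}$$ with $p,q$ positive integers, are periodic with period $2q$.
   Context: No-slip planar billiard. A disc of radius $R>0$ with rotationally symmetric mass distribution moves so that its center stays in a region $\mathcal{B}\subset\mathbb{R}^2$ (the billiard table). A wedge domain with corner angle $2\phi$ is the region bounded by two rays from a common point making angle $2\phi$. The mass distribution enters through $\gamma$ (moment of inertia $=m(\gamma R)^2$, where $m$ is the mass), equivalently the characteristic angle $\beta$ with $\gamma=\tan(\beta/2)$; for the uniform mass distribution $\gamma=1/\sqrt2$, $\cos\beta=1/3$, $\cos(\beta/2)=\sqrt{2/3}$. The configuration manifold is $M=\mathcal{B}\times\mathbb{T}$, $\mathbb{T}=\mathbb{R}/(2\pi\gamma R\,\mathbb{Z})$, where the $\mathbb{T}$-coordinate is $x=\gamma R\theta$ and $\theta$ is the disc's angle of orientation; $\partial M=\partial\mathcal{B}\times\mathbb{T}$. Tangent spaces of $M$ are identified with $\mathbb{R}^3$ with the standard inner product. At a point $a\in\partial M$ not over the corner, the product frame $(e_1,e_2(a),e_3(a))$ is the positively oriented orthonormal frame in which $e_1$ is the constant unit vector in the direction of $\mathbb{T}$, $e_2(a)$ is tangent to $\partial\mathcal{B}$,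 and $e_3(a)$ is the unit normal to $\partial M$ pointing into $M$. The no-slip collision map $C_a:\mathbb{R}^3\to\mathbb{R}^3$ is the linear map whose matrix in the product frame is $$\begin{pmatrix}-\cos\beta&-\sin\beta&0\\-\sin\beta&\cos\beta&0\\0&0&-1\end{pmatrix}.$$ The phase space is $N=\{(a,v): a\in\partial M,\ v\in\mathbb{R}^3,\ |v|=1,\ \langle v,e_3(a)\rangle>0\}$. The billiard map is $T(a,v)=(\tilde a,C_{\tilde a}v)$ with $\tilde a=a+tv$, $t=\inf\{s>0:a+sv\in\partial M\}$, where this makes sense. Since $T$ commutes with translations in the $\mathbb{T}$-direction it induces a map on the reduced phase space obtained from $N$ by forgetting the $\mathbb{T}$-coordinate of $a$ (keeping the full velocity $v\in\mathbb{R}^3$); periodicity refers to the reduced phase space. Bounded orbits are those that do not eventually escape to infinity. *)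

theory Defs
  imports "HOL-Analysis.Analysis" "HOL-Library.Real_Mod"
begin

text \<open>
  The plane is \<^typ>\<open>complex\<close>, and tangent vectors live in \<^typ>\<open>real \<times> complex\<close> with its standard
  inner product, the first component being the direction of the circle factor.
  A point of the circle $\mathbb{R}/(2\pi\gamma R\,\mathbb{Z})$ is given by its representative in
  $[0, 2\pi\gamma R)$, so a configuration is also a pair in \<^typ>\<open>real \<times> complex\<close>.

  A wedge is given by its vertex \<open>c\<close>, the direction angle \<open>\<alpha>\<close> of its axis and half its corner
  angle \<open>\<phi>\<close>.
\<close>

type_synonym config = "real \<times> complex"
type_synonym velocity = "real \<times> complex"
type_synonym state = "config \<times> velocity"

definition wedge :: "complex \<Rightarrow> real \<Rightarrow> real \<Rightarrow> complex set" where
  "wedge c \<alpha> \<phi> = {c + of_real r * cis (\<alpha> + t) | r t. 0 \<le> r \<and> - \<phi> \<le> t \<and> t \<le> \<phi>}"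

definition ray :: "complex \<Rightarrow> real \<Rightarrow> complex set" where
  "ray c \<theta> = {c + of_real r * cis \<theta> | r. 0 \<le> r}"

text \<open>Uniform mass distribution: the moment of inertia $mR^2/2$ equals $m(\gamma R)^2$.\<close>

definition uniform_gamma :: real where
  "uniform_gamma = 1 / sqrt 2"

definition characteristic_angle :: "real \<Rightarrow> real" where
  "characteristic_angle \<gamma> = 2 * arctan \<gamma>"

text \<open>
  The product frame at a boundary point over \<open>b\<close> (not the corner). The normal \<open>e3\<close> points into
  the wedge: it is the direction of the ray turned by $+\pi/2$ on the side \<open>\<alpha> - \<phi>\<close> and by
  $-\pi/2$ on the side \<open>\<alpha> + \<phi>\<close>. Orientation: the pair \<open>(e2, e3)\<close> is positively oriented in the
  plane, i.e. the normal is \<open>\<i>\<close> times the tangent.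
\<close>

definition e1 :: velocity where
  "e1 = (1, 0)"

definition e3 :: "complex \<Rightarrow> real \<Rightarrow> real \<Rightarrow> complex \<Rightarrow> velocity" where
  "e3 c \<alpha> \<phi> b = (0, if b \<in> ray c (\<alpha> + \<phi>) then - \<i> * cis (\<alpha> + \<phi>) else \<i> * cis (\<alpha> - \<phi>))"

definition e2 :: "complex \<Rightarrow> real \<Rightarrow> real \<Rightarrow> complex \<Rightarrow> velocity" where
  "e2 c \<alpha> \<phi> b = (0, - \<i> * snd (e3 c \<alpha> \<phi> b))"

definition collision_map ::
    "real \<Rightarrow> complex \<Rightarrow> real \<Rightarrow> real \<Rightarrow> complex \<Rightarrow> velocity \<Rightarrow> velocity" where
  "collision_map \<gamma> c \<alpha> \<phi> b v =
    (let \<beta> = characteristic_angle \<gamma>;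
         v1 = v \<bullet> e1; v2 = v \<bullet> e2 c \<alpha> \<phi> b; v3 = v \<bullet> e3 c \<alpha> \<phi> b
     in (- cos \<beta> * v1 - sin \<beta> * v2) *\<^sub>R e1
        + (- sin \<beta> * v1 + cos \<beta> * v2) *\<^sub>R e2 c \<alpha> \<phi> b
        + (- v3) *\<^sub>R e3 c \<alpha> \<phi> b)"

definition boundary :: "real \<Rightarrow> real \<Rightarrow> complex \<Rightarrow> real \<Rightarrow> real \<Rightarrow> config set" where
  "boundary \<gamma> R c \<alpha> \<phi> = {0..<2 * pi * \<gamma> * R} \<times> frontier (wedge c \<alpha> \<phi>)"

definition phase_space :: "real \<Rightarrow> real \<Rightarrow> complex \<Rightarrow> real \<Rightarrow> real \<Rightarrow> state set" where
  "phase_space \<gamma> R c \<alpha> \<phi> =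
    {(a, v). a \<in> boundary \<gamma> R c \<alpha> \<phi> \<and> snd a \<noteq> c \<and> norm v = 1 \<and> v \<bullet> e3 c \<alpha> \<phi> (snd a) > 0}"

text \<open>Free motion \<open>a + s v\<close>, with the circle coordinate reduced modulo $2\pi\gamma R$.\<close>

definition flight :: "real \<Rightarrow> real \<Rightarrow> state \<Rightarrow> real \<Rightarrow> config" where
  "flight \<gamma> R = (\<lambda>((x, b), (u, w)) s. ((x + s * u) rmod (2 * pi * \<gamma> * R), b + of_real s * w))"

definition hit_times :: "real \<Rightarrow> real \<Rightarrow> complex \<Rightarrow> real \<Rightarrow> real \<Rightarrow> state \<Rightarrow> real set" where
  "hit_times \<gamma> R c \<alpha> \<phi> z = {s. 0 < s \<and> flight \<gamma> R z s \<in> boundary \<gamma> R c \<alpha> \<phi>}"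

definition billiard_map :: "real \<Rightarrow> real \<Rightarrow> complex \<Rightarrow> real \<Rightarrow> real \<Rightarrow> state \<Rightarrow> state" where
  "billiard_map \<gamma> R c \<alpha> \<phi> z =
    (let a' = flight \<gamma> R z (Inf (hit_times \<gamma> R c \<alpha> \<phi> z))
     in (a', collision_map \<gamma> c \<alpha> \<phi> (snd a') (snd z)))"

text \<open>
  The states at which the billiard map makes sense: the flight returns to the boundary, and not
  at the corner (which the phase space excludes).
\<close>

definition billiard_domain :: "real \<Rightarrow> real \<Rightarrow> complex \<Rightarrow> real \<Rightarrow> real \<Rightarrow> state set" where
  "billiard_domain \<gamma> R c \<alpha> \<phi> =
    {z \<in> phase_space \<gamma> R c \<alpha> \<phi>. hit_times \<gamma> R c \<alpha> \<phi> z \<noteq> {} \<and>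
       billiard_map \<gamma> R c \<alpha> \<phi> z \<in> phase_space \<gamma> R c \<alpha> \<phi>}"

definition complete_orbit :: "real \<Rightarrow> real \<Rightarrow> complex \<Rightarrow> real \<Rightarrow> real \<Rightarrow> state \<Rightarrow> bool" where
  "complete_orbit \<gamma> R c \<alpha> \<phi> z \<longleftrightarrow>
    (\<forall>k. (billiard_map \<gamma> R c \<alpha> \<phi> ^^ k) z \<in> billiard_domain \<gamma> R c \<alpha> \<phi>)"

text \<open>
  An orbit can escape to infinity by a last flight that never meets the boundary again (then it
  is not complete) or, a priori, by collision points that tend to infinity. Bounded orbits are
  those doing neither; orbits running into the corner are not complete either and thus excluded.
\<close>

definition bounded_orbit :: "real \<Rightarrow> real \<Rightarrow> complex \<Rightarrow> real \<Rightarrow> real \<Rightarrow> state \<Rightarrow> bool" where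
  "bounded_orbit \<gamma> R c \<alpha> \<phi> z \<longleftrightarrow>
    complete_orbit \<gamma> R c \<alpha> \<phi> z \<and>
    \<not> filterlim (\<lambda>k. norm (snd (fst ((billiard_map \<gamma> R c \<alpha> \<phi> ^^ k) z)))) at_top sequentially"

text \<open>
  Projection to the reduced phase space. By the lemma below the billiard map induces a map
  there, whose iterates are the projections of the iterates of the billiard map.
\<close>

definition reduced :: "state \<Rightarrow> complex \<times> velocity" where
  "reduced z = (snd (fst z), snd z)"

lemma reduced_billiard_map_cong:
  assumes "0 < \<gamma>" "0 < R" and eq: "reduced z = reduced z'"
  shows "reduced (billiard_map \<gamma> R c \<alpha> \<phi> z) = reduced (billiard_map \<gamma> R c \<alpha> \<phi> z')"
proof -
  obtain x b u w where z: "z = ((x, b), (u, w))" by (metis surj_pair)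
  obtain x' where z': "z' = ((x', b), (u, w))"
    using eq z by (metis reduced_def fst_conv snd_conv surj_pair)
  have pos: "0 < 2 * pi * \<gamma> * R" using assms by simp
  have "y rmod (2 * pi * \<gamma> * R) \<in> {0..<2 * pi * \<gamma> * R}" for y
    using rmod_nonneg[of "2 * pi * \<gamma> * R" y] rmod_less[OF pos, of y] pos
    unfolding atLeastLessThan_iff by linarith
  then have "hit_times \<gamma> R c \<alpha> \<phi> z = hit_times \<gamma> R c \<alpha> \<phi> z'"
    by (simp add: hit_times_def boundary_def flight_def z z')
  then show ?thesis
    by (simp add: reduced_def billiard_map_def Let_def flight_def z z')
qed

definition has_period ::
    "real \<Rightarrow> real \<Rightarrow> complex \<Rightarrow> real \<Rightarrow> real \<Rightarrow> nat \<Rightarrow> state \<Rightarrow> bool" where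
  "has_period \<gamma> R c \<alpha> \<phi> n z \<longleftrightarrow>
    0 < n \<and> complete_orbit \<gamma> R c \<alpha> \<phi> z \<and>
    reduced ((billiard_map \<gamma> R c \<alpha> \<phi> ^^ n) z) = reduced z"

definition has_least_period ::
    "real \<Rightarrow> real \<Rightarrow> complex \<Rightarrow> real \<Rightarrow> real \<Rightarrow> nat \<Rightarrow> state \<Rightarrow> bool" where
  "has_least_period \<gamma> R c \<alpha> \<phi> n z \<longleftrightarrow>
    has_period \<gamma> R c \<alpha> \<phi> n z \<and> (\<forall>m<n. \<not> has_period \<gamma> R c \<alpha> \<phi> m z)"

end

theory Submission
  imports Defs
begin

text \<open>
  The collision map is the half-turn about the axis $u = -\sin(\beta/2)\,e_1 + \cos(\beta/2)\,e_2$, and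
  in a convex wedge the collisions alternate between the two sides. Two consecutive collisions
  therefore rotate the velocity by twice the angle between the two axes $u, u'$; for the uniform
  mass distribution $\langle u, u'\rangle = 1 - \frac43\cos^2\phi$, which equals $|\cos(\pi p/q)|$ for
  $\phi = \phi_{p,q}$, so the velocity recurs after $2q$ collisions. The position follows, because
  the distance from the vertex times the normal velocity is conserved.

  The vector orthogonal to both axes is reversed by every collision and yields an orbit of
  period 2; for $p = 1$ and $q \ge 2$, a small perturbation of it gives an orbit whose least
  period is $2q$.
\<close>

section \<open>Half-turns\<close>

text \<open>For a unit vector \<open>u\<close> this is the reflection in the line spanned by
  \<open>u\<close>, in dimension three the rotation by \<pi> about \<open>u\<close>.\<close>

definition half_turn :: "'a::real_inner \<Rightarrow> 'a \<Rightarrow> 'a" where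
  "half_turn u v = (2 * (v \<bullet> u)) *\<^sub>R u - v"

lemma half_turn_add: "half_turn u (v + w) = half_turn u v + half_turn u w"
  by (simp add: half_turn_def algebra_simps)

lemma half_turn_scaleR: "half_turn u (a *\<^sub>R v) = a *\<^sub>R half_turn u v"
  by (simp add: half_turn_def algebra_simps)

lemma half_turn_orthogonal: "v \<bullet> u = 0 \<Longrightarrow> half_turn u v = - v"
  by (simp add: half_turn_def)

lemma norm_half_turn:
  assumes "norm u = 1"
  shows "norm (half_turn u v) = norm v"
proof -
  have "u \<bullet> u = 1"
    using assms by (simp add: norm_eq_1)
  then have "half_turn u v \<bullet> half_turn u v = v \<bullet> v"
    by (simp add: half_turn_def inner_diff_left inner_diff_right inner_commute algebra_simps)
  then show ?thesis
    by (simp add: norm_eq_sqrt_inner)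
qed

text \<open>For orthonormal \<open>u\<close> and \<open>p\<close> this turns \<open>p\<close>
  towards \<open>u\<close> by the angle \<open>t\<close> and fixes the orthogonal complement of
  their plane. Writing it as \<open>v\<close> plus corrections avoids decomposing
  \<open>v\<close>.\<close>

definition plane_rotation :: "'a::real_inner \<Rightarrow> 'a \<Rightarrow> real \<Rightarrow> 'a \<Rightarrow> 'a" where
  "plane_rotation u p t v =
     v + ((cos t - 1) * (v \<bullet> u) + sin t * (v \<bullet> p)) *\<^sub>R u
       + ((cos t - 1) * (v \<bullet> p) - sin t * (v \<bullet> u)) *\<^sub>R p"

lemma plane_rotation_inner:
  assumes "u \<bullet> u = 1" "p \<bullet> p = 1" "u \<bullet> p = 0"
  shows "plane_rotation u p t v \<bullet> u = cos t * (v \<bullet> u) + sin t * (v \<bullet> p)"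
    and "plane_rotation u p t v \<bullet> p = cos t * (v \<bullet> p) - sin t * (v \<bullet> u)"
  using assms by (simp_all add: plane_rotation_def inner_add_left inner_commute[of p u] algebra_simps)

lemma plane_rotation_add:
  assumes "u \<bullet> u = 1" "p \<bullet> p = 1" "u \<bullet> p = 0"
  shows "plane_rotation u p s (plane_rotation u p t v) = plane_rotation u p (s + t) v"
proof -
  let ?w = "plane_rotation u p t v"
  have "plane_rotation u p s ?w =
      v + ((cos t - 1) * (v \<bullet> u) + sin t * (v \<bullet> p) + ((cos s - 1) * (?w \<bullet> u) + sin s * (?w \<bullet> p))) *\<^sub>R u
       + ((cos t - 1) * (v \<bullet> p) - sin t * (v \<bullet> u) + ((cos s - 1) * (?w \<bullet> p) - sin s * (?w \<bullet> u))) *\<^sub>R p"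
    unfolding plane_rotation_def[of u p s] by (simp add: plane_rotation_def[of u p t v] scaleR_add_left)
  also have "\<dots> = plane_rotation u p (s + t) v"
    unfolding plane_rotation_inner[OF assms] plane_rotation_def[of u p "s + t"] cos_add sin_add
    by (rule arg_cong2[where f = "\<lambda>a b. v + a *\<^sub>R u + b *\<^sub>R p"]) (simp_all add: algebra_simps)
  finally show ?thesis .
qed

text \<open>Both half-turns negate what is orthogonal to \<open>u\<close> and \<open>p\<close>. In
  the plane of these vectors they are reflections in lines at angle \<delta>, so they compose to a
  rotation by twice that angle.\<close>

lemma half_turn_comp:
  assumes "u \<bullet> u = 1" "p \<bullet> p = 1" "u \<bullet> p = 0"
  shows "half_turn u (half_turn (cos \<delta> *\<^sub>R u + sin \<delta> *\<^sub>R p) v) = plane_rotation u p (2 * \<delta>) v"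
proof -
  have s: "sin \<delta> * (sin \<delta> * x) = x - cos \<delta> * (cos \<delta> * x)" for x
  proof -
    have "sin \<delta> * sin \<delta> = 1 - cos \<delta> * cos \<delta>"
      using sin_cos_squared_add[of \<delta>] by (simp add: power2_eq_square)
    then show ?thesis
      by (metis left_diff_distrib mult.assoc mult_1)
  qed
  define g where "g = v \<bullet> (cos \<delta> *\<^sub>R u + sin \<delta> *\<^sub>R p)"
  define h where "h = half_turn (cos \<delta> *\<^sub>R u + sin \<delta> *\<^sub>R p) v \<bullet> u"
  have g: "g = cos \<delta> * (v \<bullet> u) + sin \<delta> * (v \<bullet> p)"
    by (simp add: g_def inner_add_right)
  have h: "h = 2 * g * cos \<delta> - v \<bullet> u"
    using assms
    by (simp add: h_def half_turn_def g_def[symmetric] inner_diff_left inner_add_left inner_commute[of p u])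
  have "half_turn u (half_turn (cos \<delta> *\<^sub>R u + sin \<delta> *\<^sub>R p) v) =
      v + (2 * h - 2 * g * cos \<delta>) *\<^sub>R u + (- (2 * g * sin \<delta>)) *\<^sub>R p"
    unfolding half_turn_def[of u] h_def[symmetric]
    by (simp add: half_turn_def g_def[symmetric] scaleR_add_right scaleR_diff_left)
  also have "\<dots> = plane_rotation u p (2 * \<delta>) v"
    unfolding plane_rotation_def cos_double sin_double h g
    by (rule arg_cong2[where f = "\<lambda>a b. v + a *\<^sub>R u + b *\<^sub>R p"])
      (simp_all add: power2_eq_square algebra_simps s)
  finally show ?thesis .
qed

lemma half_turn_comp_funpow:
  assumes "norm u = 1" "norm u' = 1" "u \<bullet> u' = cos \<delta>" "sin \<delta> \<noteq> 0"
  obtains p where "p \<bullet> u = 0" "u' = cos \<delta> *\<^sub>R u + sin \<delta> *\<^sub>R p" "p \<bullet> p = 1"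
    "\<And>m v. ((half_turn u \<circ> half_turn u') ^^ m) v = plane_rotation u p (2 * real m * \<delta>) v"
proof -
  have uu: "u \<bullet> u = 1" "u' \<bullet> u' = 1"
    using assms by (simp_all add: norm_eq_1)
  \<comment> \<open>Gram-Schmidt: the bracket has length |sin \<delta>|. Dividing by the sine with
    its sign makes \<open>u' = cos \<delta> *\<^sub>R u + sin \<delta> *\<^sub>R p\<close>
    hold.\<close>
  define p where "p = (1 / sin \<delta>) *\<^sub>R (u' - cos \<delta> *\<^sub>R u)"
  have pu: "u \<bullet> p = 0"
    by (simp add: p_def inner_diff_right uu assms)
  have u': "u' = cos \<delta> *\<^sub>R u + sin \<delta> *\<^sub>R p"
    using assms(4) by (simp add: p_def)
  have "(u' - cos \<delta> *\<^sub>R u) \<bullet> (u' - cos \<delta> *\<^sub>R u) = 1 - (cos \<delta>)\<^sup>2"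
    by (simp add: inner_diff_right inner_diff_left uu assms inner_commute[of u' u] power2_eq_square)
  then have "p \<bullet> p = (sin \<delta>)\<^sup>2 / (sin \<delta>)\<^sup>2"
    unfolding sin_squared_eq[of \<delta>, symmetric] by (simp add: p_def power2_eq_square)
  then have pp: "p \<bullet> p = 1"
    using assms(4) by simp
  have comp: "half_turn u (half_turn u' w) = plane_rotation u p (2 * \<delta>) w" for w
    unfolding u' by (rule half_turn_comp[OF uu(1) pp pu])
  have "((half_turn u \<circ> half_turn u') ^^ m) v = plane_rotation u p (2 * real m * \<delta>) v" for m v
  proof (induction m)
    case 0
    show ?case by (simp add: plane_rotation_def)
  next
    case (Suc m)
    have "((half_turn u \<circ> half_turn u') ^^ Suc m) v =
        plane_rotation u p (2 * \<delta>) (plane_rotation u p (2 * real m * \<delta>) v)"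
      by (simp only: funpow.simps o_apply[of "half_turn u \<circ> half_turn u'"] comp_apply[of "half_turn u"] comp Suc)
    then show ?case
      by (simp only: plane_rotation_add[OF uu(1) pp pu]) (simp add: algebra_simps)
  qed
  then show ?thesis
    using that[of p] pu pp u' inner_commute[of p u] by metis
qed

text \<open>For independent axes the power is a rotation whose total angle is a multiple of 2\<pi>.
  Parallel axes span no plane; there the two half-turns coincide and cancel.\<close>

lemma half_turn_comp_funpow_eq_id:
  assumes "norm u = 1" "norm u' = 1" "u \<bullet> u' = cos \<delta>" "cos (2 * real m * \<delta>) = 1"
  shows "((half_turn u \<circ> half_turn u') ^^ m) v = v"
proof (cases "sin \<delta> = 0")
  case False
  have "sin (2 * real m * \<delta>) = 0"
    using assms(4) by (simp add: cos_one_sin_zero)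
  moreover obtain p where
    "((half_turn u \<circ> half_turn u') ^^ m) v = plane_rotation u p (2 * real m * \<delta>) v"
    using half_turn_comp_funpow[OF assms(1-3) False] by metis
  ultimately show ?thesis
    using assms(4) by (simp add: plane_rotation_def)
next
  case True
  have uu: "u \<bullet> u = 1" "u' \<bullet> u' = 1"
    using assms by (simp_all add: norm_eq_1)
  have "(u' - cos \<delta> *\<^sub>R u) \<bullet> (u' - cos \<delta> *\<^sub>R u) = (sin \<delta>)\<^sup>2"
    unfolding sin_squared_eq
    by (simp add: inner_diff_right inner_diff_left uu assms inner_commute[of u' u] power2_eq_square)
  then have u': "u' = cos \<delta> *\<^sub>R u"
    using True by simp
  have "cos \<delta> * cos \<delta> = 1"
    using True sin_cos_squared_add[of \<delta>] by (simp add: power2_eq_square)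
  then have "half_turn u' = half_turn u"
    by (simp add: fun_eq_iff half_turn_def u' mult.commute mult.left_commute)
  moreover have "half_turn u (half_turn u w) = w" for w
    by (simp add: half_turn_def inner_diff_left uu)
  ultimately have "half_turn u \<circ> half_turn u' = id"
    by (simp add: fun_eq_iff)
  then show ?thesis by simp
qed

section \<open>Convex wedges\<close>

text \<open>The side at \<alpha> + \<phi> is coded by \<open>True\<close> and the other by
  \<open>False\<close>, so that passing to the opposite side is negation.\<close>

definition side_dir :: "real \<Rightarrow> real \<Rightarrow> bool \<Rightarrow> complex" where
  "side_dir \<alpha> \<phi> \<sigma> = (if \<sigma> then cis (\<alpha> + \<phi>) else cis (\<alpha> - \<phi>))"

definition side_normal :: "real \<Rightarrow> real \<Rightarrow> bool \<Rightarrow> complex" where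
  "side_normal \<alpha> \<phi> \<sigma> = (if \<sigma> then - \<i> * cis (\<alpha> + \<phi>) else \<i> * cis (\<alpha> - \<phi>))"

lemma inner_cis_normal:
  "(of_real r * cis (\<alpha> + t)) \<bullet> side_normal \<alpha> \<phi> True = r * sin (\<phi> - t)"
  "(of_real r * cis (\<alpha> + t)) \<bullet> side_normal \<alpha> \<phi> False = r * sin (\<phi> + t)"
proof -
  have eq: "(\<alpha> + \<phi>) - (\<alpha> + t) = \<phi> - t" "(\<alpha> + t) - (\<alpha> - \<phi>) = \<phi> + t"
    by simp_all
  note sin = sin_diff[of "\<alpha> + \<phi>" "\<alpha> + t", unfolded eq] sin_diff[of "\<alpha> + t" "\<alpha> - \<phi>", unfolded eq]
  show
    "(of_real r * cis (\<alpha> + t)) \<bullet> side_normal \<alpha> \<phi> True = r * sin (\<phi> - t)"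
    "(of_real r * cis (\<alpha> + t)) \<bullet> side_normal \<alpha> \<phi> False = r * sin (\<phi> + t)"
    unfolding sin by (simp_all add: side_normal_def inner_complex_def algebra_simps)
qed

text \<open>With a corner angle of at most \<pi> the wedge is convex, and membership becomes two
  linear inequalities, which are easy to follow along a straight flight.\<close>

lemma wedge_eq_halfspaces:
  assumes "0 < \<phi>" "\<phi> \<le> pi / 2"
  shows "wedge c \<alpha> \<phi> = {b. 0 \<le> (b - c) \<bullet> side_normal \<alpha> \<phi> True \<and> 0 \<le> (b - c) \<bullet> side_normal \<alpha> \<phi> False}"
    (is "_ = ?H")
proof (intro equalityI subsetI)
  fix b assume "b \<in> wedge c \<alpha> \<phi>"
  then obtain r t where b: "b - c = of_real r * cis (\<alpha> + t)" and rt: "0 \<le> r" "- \<phi> \<le> t" "t \<le> \<phi>"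
    by (auto simp: wedge_def)
  have "0 \<le> sin (\<phi> - t)" "0 \<le> sin (\<phi> + t)"
    using rt assms by (auto intro!: sin_ge_zero)
  then show "b \<in> ?H"
    using rt by (simp only: mem_Collect_eq b inner_cis_normal) simp
next
  fix b assume b: "b \<in> ?H"
  define r where "r = norm (b - c)"
  \<comment> \<open>The polar angle measured from the axis of the wedge, between -\<pi> and \<pi>.
    In this range the signs of the two sines confine it to the wedge.\<close>
  define t where "t = Arg ((b - c) * cis (- \<alpha>))"
  have t: "- pi < t" "t \<le> pi"
    using Arg_bounded by (auto simp: t_def)
  have "of_real r * cis t = (b - c) * cis (- \<alpha>)"
    using rcis_cmod_Arg[of "(b - c) * cis (- \<alpha>)"] by (simp add: r_def t_def norm_mult rcis_def)
  then have "of_real r * cis t * cis \<alpha> = (b - c) * (cis (- \<alpha>) * cis \<alpha>)"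
    by simp
  then have bc: "b - c = of_real r * cis (\<alpha> + t)"
    by (simp add: cis_mult mult.assoc add.commute)
  show "b \<in> wedge c \<alpha> \<phi>"
  proof (cases "r = 0")
    case True
    then have "b = c + of_real 0 * cis (\<alpha> + 0)" using bc by simp
    then show ?thesis using assms unfolding wedge_def by force
  next
    case False
    then have r: "0 < r" by (simp add: r_def)
    have "0 \<le> r * sin (\<phi> - t)" "0 \<le> r * sin (\<phi> + t)"
      using b by (simp_all only: mem_Collect_eq bc inner_cis_normal)
    then have s: "0 \<le> sin (\<phi> - t)" "0 \<le> sin (\<phi> + t)"
      using r by (simp_all add: zero_le_mult_iff)
    have "t \<le> \<phi>"
    proof (rule ccontr)
      assume "\<not> t \<le> \<phi>"
      then have "0 < sin (t - \<phi>)"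
        using t assms by (intro sin_gt_zero) auto
      then show False using s(1) sin_minus[of "t - \<phi>"] by simp
    qed
    moreover have "- \<phi> \<le> t"
    proof (rule ccontr)
      assume "\<not> - \<phi> \<le> t"
      then have "0 < sin (- (\<phi> + t))"
        using t assms by (intro sin_gt_zero) auto
      then show False using s(2) sin_minus[of "\<phi> + t"] by simp
    qed
    moreover have "b = c + of_real r * cis (\<alpha> + t)"
      using bc by (simp add: algebra_simps)
    ultimately show ?thesis
      using r unfolding wedge_def by fastforce
  qed
qed

lemma side_normal_nonzero: "side_normal \<alpha> \<phi> \<sigma> \<noteq> 0"
  by (simp add: side_normal_def)

lemma frontier_wedge:
  assumes "0 < \<phi>" "\<phi> \<le> pi / 2"
  shows "b \<in> frontier (wedge c \<alpha> \<phi>) \<longleftrightarrow>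
    (\<forall>\<sigma>. 0 \<le> (b - c) \<bullet> side_normal \<alpha> \<phi> \<sigma>) \<and> (\<exists>\<sigma>. (b - c) \<bullet> side_normal \<alpha> \<phi> \<sigma> = 0)"
proof -
  define H where "H \<sigma> = {b. side_normal \<alpha> \<phi> \<sigma> \<bullet> b \<ge> side_normal \<alpha> \<phi> \<sigma> \<bullet> c}" for \<sigma>
  have W: "wedge c \<alpha> \<phi> = H True \<inter> H False"
    unfolding wedge_eq_halfspaces[OF assms] H_def by (auto simp: inner_diff_left inner_commute)
  have "closed (wedge c \<alpha> \<phi>)"
    unfolding W H_def by (intro closed_Int closed_halfspace_ge)
  moreover have "interior (wedge c \<alpha> \<phi>) =
      {b. side_normal \<alpha> \<phi> True \<bullet> b > side_normal \<alpha> \<phi> True \<bullet> c} \<inter>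
      {b. side_normal \<alpha> \<phi> False \<bullet> b > side_normal \<alpha> \<phi> False \<bullet> c}"
    unfolding W H_def interior_Int by (simp add: interior_halfspace_ge side_normal_nonzero)
  moreover have "(b - c) \<bullet> side_normal \<alpha> \<phi> \<sigma> = side_normal \<alpha> \<phi> \<sigma> \<bullet> b - side_normal \<alpha> \<phi> \<sigma> \<bullet> c" for \<sigma>
    by (simp add: inner_diff_left inner_commute)
  ultimately show ?thesis
    by (auto simp: frontier_def W H_def all_bool_eq ex_bool_eq)
qed

text \<open>Both inner normals are \<open>cis \<alpha>\<close> here, so a flight leaving the
  boundary line with positive normal velocity never returns. The angle formula of the theorem yields
  this wedge when q divides p.\<close>

lemma no_complete_orbit_half_plane: "\<not> complete_orbit \<gamma> R c \<alpha> (pi / 2) z"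
proof
  assume "complete_orbit \<gamma> R c \<alpha> (pi / 2) z"
  then have dom: "z \<in> billiard_domain \<gamma> R c \<alpha> (pi / 2)"
    unfolding complete_orbit_def using funpow_0 by metis
  obtain x b u w where z: "z = ((x, b), (u, w))" by (metis surj_pair)
  have n: "side_normal \<alpha> (pi / 2) \<sigma> = cis \<alpha>" for \<sigma>
    by (auto simp: side_normal_def complex_eq_iff sin_add cos_add sin_diff cos_diff)
  have e3: "e3 c \<alpha> (pi / 2) b = (0, cis \<alpha>)"
    using n[of True] n[of False] by (simp add: e3_def side_normal_def)
  have b: "(b - c) \<bullet> cis \<alpha> = 0" and w: "0 < w \<bullet> cis \<alpha>"
    using dom by (auto simp: billiard_domain_def phase_space_def boundary_def z frontier_wedge n e3)
  from dom obtain s where "0 < s" "b + of_real s * w \<in> frontier (wedge c \<alpha> (pi / 2))"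
    by (auto simp: billiard_domain_def hit_times_def boundary_def z flight_def)
  then have "(b + s *\<^sub>R w - c) \<bullet> cis \<alpha> = 0"
    by (simp add: frontier_wedge n scaleR_conv_of_real)
  then have "(b - c) \<bullet> cis \<alpha> + s * (w \<bullet> cis \<alpha>) = 0"
    by (simp add: inner_diff_left inner_add_left)
  with b w \<open>0 < s\<close> show False by simp
qed

section \<open>Flights and collisions in a wedge with acute half-angle\<close>

locale convex_wedge =
  fixes \<gamma> R :: real and c :: complex and \<alpha> \<phi> :: real
  assumes \<gamma>_pos: "0 < \<gamma>" and R_pos: "0 < R" and \<phi>_pos: "0 < \<phi>" and \<phi>_less: "\<phi> < pi / 2"
begin

abbreviation "n \<equiv> side_normal \<alpha> \<phi>"
abbreviation "d \<equiv> side_dir \<alpha> \<phi>"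
abbreviation "T \<equiv> billiard_map \<gamma> R c \<alpha> \<phi>"
abbreviation "circle \<equiv> {0..<2 * pi * \<gamma> * R}"

definition point :: "bool \<Rightarrow> real \<Rightarrow> complex" where
  "point \<sigma> r = c + of_real r * d \<sigma>"

text \<open>Here \<open>arctan \<gamma>\<close> is half the characteristic angle and
  \<open>- \<i> * n \<sigma>\<close> is the planar part of \<open>e2\<close>; the vector is the
  eigenvector of the collision matrix for the eigenvalue 1.\<close>

definition axis :: "bool \<Rightarrow> velocity" where
  "axis \<sigma> = (- sin (arctan \<gamma>), of_real (cos (arctan \<gamma>)) * (- \<i> * n \<sigma>))"

lemma sin_pos: "0 < sin (2 * \<phi>)"
  using \<phi>_pos \<phi>_less by (intro sin_gt_zero) auto

lemma rmod_circle: "y rmod (2 * pi * \<gamma> * R) \<in> circle"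
proof -
  have pos: "0 < 2 * pi * \<gamma> * R" using \<gamma>_pos R_pos by simp
  show ?thesis
    using rmod_nonneg[of "2 * pi * \<gamma> * R" y] rmod_less[OF pos, of y] pos
    unfolding atLeastLessThan_iff by linarith
qed

lemma point_inner_normal:
  "(point \<sigma> r - c) \<bullet> n \<sigma> = 0" "(point \<sigma> r - c) \<bullet> n (\<not> \<sigma>) = r * sin (2 * \<phi>)"
  using inner_cis_normal[of r \<alpha> \<phi> \<phi>] inner_cis_normal[of r \<alpha> "- \<phi>" \<phi>]
  by (cases \<sigma>; simp add: point_def side_dir_def)+

text \<open>The direction and the normal of a side form an orthonormal basis, so a point with zero
  normal coordinate lies on the line of that side. Its signed distance from the opposite side, r
  sin(2\<phi>), then determines r. This locates the landing point of a flight.\<close>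

lemma point_eqI:
  assumes "(b - c) \<bullet> n \<sigma> = 0"
  shows "b = point \<sigma> ((b - c) \<bullet> n (\<not> \<sigma>) / sin (2 * \<phi>))"
proof -
  have orth: "w = of_real (w \<bullet> d \<sigma>) * d \<sigma> + of_real (w \<bullet> n \<sigma>) * n \<sigma>" for w
  proof -
    have "sin x * (sin x * y) = y - cos x * (cos x * y)" for x y :: real
      using sin_cos_squared_add[of x]
      by (metis add_diff_cancel_left' left_diff_distrib mult.assoc mult_1 power2_eq_square add.commute)
    then show ?thesis
      by (auto simp: side_dir_def side_normal_def complex_eq_iff inner_complex_def algebra_simps)
  qed
  define \<rho> where "\<rho> = (b - c) \<bullet> d \<sigma>"
  have b: "b = point \<sigma> \<rho>"
    using orth[of "b - c"] assms by (simp add: point_def \<rho>_def algebra_simps)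
  then have "(b - c) \<bullet> n (\<not> \<sigma>) = \<rho> * sin (2 * \<phi>)"
    using point_inner_normal(2) by simp
  then show ?thesis
    using b sin_pos by simp
qed

lemma frontier_iff: "b \<in> frontier (wedge c \<alpha> \<phi>) \<longleftrightarrow> (\<exists>\<sigma> r. 0 \<le> r \<and> b = point \<sigma> r)"
proof
  assume "b \<in> frontier (wedge c \<alpha> \<phi>)"
  then obtain \<sigma> where "(b - c) \<bullet> n \<sigma> = 0" "0 \<le> (b - c) \<bullet> n (\<not> \<sigma>)"
    using \<phi>_pos \<phi>_less by (auto simp: frontier_wedge)
  then show "\<exists>\<sigma> r. 0 \<le> r \<and> b = point \<sigma> r"
    using point_eqI sin_pos by (metis divide_nonneg_pos)
next
  assume "\<exists>\<sigma> r. 0 \<le> r \<and> b = point \<sigma> r"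
  then obtain \<sigma> r where "0 \<le> r" and b: "b = point \<sigma> r" by blast
  then have "0 \<le> (b - c) \<bullet> n \<tau>" for \<tau>
    using point_inner_normal[of \<sigma> r] sin_pos by (cases "\<tau> = \<sigma>") auto
  then show "b \<in> frontier (wedge c \<alpha> \<phi>)"
    using point_inner_normal(1)[of \<sigma> r] \<phi>_pos \<phi>_less by (auto simp: frontier_wedge b)
qed

lemma point_eq_vertex_iff: "point \<sigma> r = c \<longleftrightarrow> r = 0"
  by (simp add: point_def side_dir_def)

lemma point_eq_iff:
  assumes "0 < r"
  shows "point \<sigma> r = point \<tau> s \<longleftrightarrow> \<sigma> = \<tau> \<and> r = s"
proof
  assume eq: "point \<sigma> r = point \<tau> s"
  then have "\<sigma> = \<tau>"
    using assms sin_pos point_inner_normal[of \<sigma> r] point_inner_normal[of \<tau> s]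
    by (cases \<sigma>; cases \<tau>) auto
  then show "\<sigma> = \<tau> \<and> r = s"
    using eq by (simp add: point_def side_dir_def split: if_splits)
qed simp

lemma e3_point:
  assumes "0 < r"
  shows "e3 c \<alpha> \<phi> (point \<sigma> r) = (0, n \<sigma>)"
proof -
  have "point \<sigma> r \<in> ray c (\<alpha> + \<phi>) \<longleftrightarrow> (\<exists>s\<ge>0. point \<sigma> r = point True s)"
    by (auto simp: ray_def point_def[of True] side_dir_def)
  then have "point \<sigma> r \<in> ray c (\<alpha> + \<phi>) \<longleftrightarrow> \<sigma>"
    using point_eq_iff[OF assms] assms by (cases \<sigma>) auto
  then show ?thesis
    by (simp add: e3_def side_normal_def)
qed

text \<open>By the double-angle formulas the collision matrix has eigenvalue 1 on
  \<open>axis \<sigma>\<close> and -1 on its orthogonal complement, which contains the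
  normal.\<close>

lemma collision_point:
  assumes "0 < r"
  shows "collision_map \<gamma> c \<alpha> \<phi> (point \<sigma> r) v = half_turn (axis \<sigma>) v"
proof -
  define h where "h = arctan \<gamma>"
  define m where "m = n \<sigma>"
  obtain a w where v: "v = (a, w)" by fastforce
  have m: "(Re m)\<^sup>2 + (Im m)\<^sup>2 = 1"
    by (simp add: m_def side_normal_def)
  have "w = of_real (w \<bullet> (- \<i> * m)) * (- \<i> * m) + of_real (w \<bullet> m) * m"
  proof -
    have "w = of_real ((Re m)\<^sup>2 + (Im m)\<^sup>2) * w" using m by simp
    then show ?thesis
      by (auto simp: complex_eq_iff inner_complex_def algebra_simps power2_eq_square)
  qed
  then obtain v2 v3 where v2: "v2 = w \<bullet> (- \<i> * m)" and v3: "v3 = w \<bullet> m"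
    and w: "w = of_real v2 * (- \<i> * m) + of_real v3 * m" by blast
  have c1: "cos (2 * h) = 1 - 2 * (sin h)\<^sup>2" "cos (2 * h) = 2 * (cos h)\<^sup>2 - 1"
    by (rule cos_double_sin cos_double_cos)+
  have "v \<bullet> axis \<sigma> = - sin h * a + cos h * v2"
    by (simp add: v axis_def h_def[symmetric] m_def[symmetric] v2 scaleR_conv_of_real[symmetric])
  then have "half_turn (axis \<sigma>) v =
    (2 * (- sin h * a + cos h * v2) * (- sin h) - a,
     of_real (2 * (- sin h * a + cos h * v2) * cos h) * (- \<i> * m) - w)"
    by (simp add: half_turn_def v axis_def h_def[symmetric] m_def[symmetric] scaleR_conv_of_real)
  also have "\<dots> = (- cos (2 * h) * a - sin (2 * h) * v2,
     of_real (- sin (2 * h) * a + cos (2 * h) * v2) * (- \<i> * m) - of_real v3 * m)"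
  proof -
    have 1: "2 * (- sin h * a + cos h * v2) * (- sin h) - a = - cos (2 * h) * a - sin (2 * h) * v2"
      unfolding c1(1) sin_double by (simp add: algebra_simps power2_eq_square)
    have 2: "2 * (- sin h * a + cos h * v2) * cos h = (- sin (2 * h) * a + cos (2 * h) * v2) + v2"
      unfolding c1(2) sin_double by (simp add: algebra_simps power2_eq_square)
    have 3: "of_real (x + v2) * (- \<i> * m) - w = of_real x * (- \<i> * m) - of_real v3 * m" for x
      by (subst w) (simp add: algebra_simps)
    show ?thesis
      unfolding 1 2 3 by simp
  qed
  also have "\<dots> = collision_map \<gamma> c \<alpha> \<phi> (point \<sigma> r) v"
    by (simp add: collision_map_def characteristic_angle_def Let_def e2_def e3_point[OF assms]
        e1_def m_def[symmetric] v h_def[symmetric] v2 v3 scaleR_conv_of_real)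
  finally show ?thesis by simp
qed

lemma norm_normal: "norm (n \<sigma>) = 1"
  by (simp add: side_normal_def norm_mult)

lemma inner_normal_bound: "\<bar>snd v \<bullet> n \<sigma>\<bar> \<le> norm (v :: velocity)"
proof -
  have "\<bar>snd v \<bullet> n \<sigma>\<bar> \<le> norm (snd v)"
    using Cauchy_Schwarz_ineq2[of "snd v" "n \<sigma>"] by (simp add: norm_normal)
  also have "norm (snd v) \<le> norm v"
    by (metis norm_snd_le prod.collapse)
  finally show ?thesis .
qed

lemma norm_axis: "norm (axis \<sigma>) = 1"
proof -
  have "norm (snd (axis \<sigma>)) = \<bar>cos (arctan \<gamma>)\<bar>"
    by (simp add: axis_def norm_mult norm_normal)
  then show ?thesis
    by (simp add: norm_prod_def axis_def)
qed

text \<open>The circle components multiply to the squared sine, and the planar tangents of the two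
  sides, oriented by the inward normals, enclose the angle \<pi> - 2\<phi>.\<close>

lemma axis_inner_axis:
  "axis \<sigma> \<bullet> axis (\<not> \<sigma>) = (sin (arctan \<gamma>))\<^sup>2 - (cos (arctan \<gamma>))\<^sup>2 * cos (2 * \<phi>)"
proof -
  have "cos (2 * \<phi>) = cos ((\<alpha> + \<phi>) - (\<alpha> - \<phi>))" by simp
  then have "cos (2 * \<phi>) = cos (\<alpha> + \<phi>) * cos (\<alpha> - \<phi>) + sin (\<alpha> + \<phi>) * sin (\<alpha> - \<phi>)"
    by (simp only: cos_diff)
  then have "(- \<i> * n \<sigma>) \<bullet> (- \<i> * n (\<not> \<sigma>)) = - cos (2 * \<phi>)"
    by (simp add: side_normal_def inner_complex_def algebra_simps)
  then show ?thesis
    by (simp add: axis_def scaleR_conv_of_real[symmetric] power2_eq_square)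
qed

text \<open>The axis is tangent to the boundary, so the half-turn negates the normal
  direction.\<close>

lemma half_turn_axis_normal: "snd (half_turn (axis \<sigma>) v) \<bullet> n \<sigma> = - (snd v \<bullet> n \<sigma>)"
proof -
  have "(- \<i> * n \<sigma>) \<bullet> n \<sigma> = 0"
    by (simp add: inner_complex_def)
  then have "snd (axis \<sigma>) \<bullet> n \<sigma> = 0"
    by (simp add: axis_def scaleR_conv_of_real[symmetric])
  then show ?thesis
    by (simp add: half_turn_def inner_diff_left)
qed

lemma phase_space_iff:
  "((x, b), v) \<in> phase_space \<gamma> R c \<alpha> \<phi> \<longleftrightarrow>
    x \<in> circle \<and> norm v = 1 \<and> (\<exists>\<sigma> r. 0 < r \<and> b = point \<sigma> r \<and> 0 < snd v \<bullet> n \<sigma>)"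
proof -
  have "b \<in> frontier (wedge c \<alpha> \<phi>) \<and> b \<noteq> c \<longleftrightarrow> (\<exists>\<sigma> r. 0 < r \<and> b = point \<sigma> r)"
    unfolding frontier_iff by (metis order_less_le point_eq_vertex_iff)
  then have "((x, b), v) \<in> phase_space \<gamma> R c \<alpha> \<phi> \<longleftrightarrow>
      x \<in> circle \<and> norm v = 1 \<and> (\<exists>\<sigma> r. 0 < r \<and> b = point \<sigma> r) \<and> 0 < v \<bullet> e3 c \<alpha> \<phi> b"
    by (auto simp: phase_space_def boundary_def)
  also have "\<dots> \<longleftrightarrow> x \<in> circle \<and> norm v = 1 \<and> (\<exists>\<sigma> r. 0 < r \<and> b = point \<sigma> r \<and> 0 < snd v \<bullet> n \<sigma>)"
    by (auto simp: e3_point inner_prod_def) blast+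
  finally show ?thesis .
qed

text \<open>Along the flight the distance from the starting side grows at positive speed, so only
  the opposite side can be hit. The distance from that side is affine in time with initial value r
  sin(2\<phi>) > 0; it vanishes at a positive time exactly if its slope is negative.\<close>

lemma hit_times_point:
  assumes "0 < r" "0 < snd v \<bullet> n \<sigma>"
  shows "hit_times \<gamma> R c \<alpha> \<phi> ((x, point \<sigma> r), v) =
    (if snd v \<bullet> n (\<not> \<sigma>) < 0 then {r * sin (2 * \<phi>) / (- (snd v \<bullet> n (\<not> \<sigma>)))} else {})"
proof -
  obtain u w where v: "v = (u, w)" by fastforce
  have f: "(point \<sigma> r + of_real s * w - c) \<bullet> n \<sigma> = s * (w \<bullet> n \<sigma>)"
    "(point \<sigma> r + of_real s * w - c) \<bullet> n (\<not> \<sigma>) = r * sin (2 * \<phi>) + s * (w \<bullet> n (\<not> \<sigma>))" for s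
    using point_inner_normal[of \<sigma> r]
    by (simp_all add: inner_diff_left inner_add_left scaleR_conv_of_real[symmetric])
  have *: "(\<forall>\<tau>. P \<tau>) \<longleftrightarrow> P \<sigma> \<and> P (\<not> \<sigma>)" "(\<exists>\<tau>. P \<tau>) \<longleftrightarrow> P \<sigma> \<or> P (\<not> \<sigma>)" for P :: "bool \<Rightarrow> bool"
    by (cases \<sigma>; auto simp: all_bool_eq ex_bool_eq)+
  have "s \<in> hit_times \<gamma> R c \<alpha> \<phi> ((x, point \<sigma> r), v) \<longleftrightarrow> 0 < s \<and> r * sin (2 * \<phi>) + s * (w \<bullet> n (\<not> \<sigma>)) = 0" for s
  proof -
    have "s \<in> hit_times \<gamma> R c \<alpha> \<phi> ((x, point \<sigma> r), v) \<longleftrightarrow>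
        0 < s \<and> point \<sigma> r + of_real s * w \<in> frontier (wedge c \<alpha> \<phi>)"
      using rmod_circle by (simp add: hit_times_def boundary_def flight_def v)
    also have "\<dots> \<longleftrightarrow> 0 < s \<and> r * sin (2 * \<phi>) + s * (w \<bullet> n (\<not> \<sigma>)) = 0"
      using assms \<phi>_pos \<phi>_less unfolding frontier_wedge[OF \<phi>_pos order_less_imp_le[OF \<phi>_less]] * f v
      by auto
    finally show ?thesis .
  qed
  moreover have rs: "0 < r * sin (2 * \<phi>)"
    using assms sin_pos by simp
  have "0 < s \<and> r * sin (2 * \<phi>) + s * e = 0 \<longleftrightarrow> e < 0 \<and> s = r * sin (2 * \<phi>) / (- e)" for s e
  proof
    assume s: "0 < s \<and> r * sin (2 * \<phi>) + s * e = 0"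
    then have "s * e < 0" using rs by linarith
    then have "e < 0" using s by (simp add: mult_less_0_iff)
    then show "e < 0 \<and> s = r * sin (2 * \<phi>) / (- e)"
      using s by (simp add: field_simps)
  next
    assume "e < 0 \<and> s = r * sin (2 * \<phi>) / (- e)"
    then show "0 < s \<and> r * sin (2 * \<phi>) + s * e = 0"
      using rs by (simp add: divide_pos_neg)
  qed
  ultimately show ?thesis
    by (auto simp: v)
qed

text \<open>At the hit time \<open>t\<close> the distance from the starting side is
  \<open>t * (w \<bullet> n \<sigma>)\<close>; dividing by sin(2\<phi>) gives the distance from the
  vertex. The circle coordinate stays unspecified because periodicity in the reduced phase space
  ignores it.\<close>

lemma billiard_map_point:
  assumes "0 < r" "0 < snd v \<bullet> n \<sigma>" "snd v \<bullet> n (\<not> \<sigma>) < 0"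
  obtains x' where "x' \<in> circle"
    "T ((x, point \<sigma> r), v) =
      ((x', point (\<not> \<sigma>) (r * (snd v \<bullet> n \<sigma>) / (- (snd v \<bullet> n (\<not> \<sigma>))))), half_turn (axis (\<not> \<sigma>)) v)"
proof -
  obtain u w where v: "v = (u, w)" by fastforce
  define t where "t = r * sin (2 * \<phi>) / (- (w \<bullet> n (\<not> \<sigma>)))"
  define r' where "r' = r * (w \<bullet> n \<sigma>) / (- (w \<bullet> n (\<not> \<sigma>)))"
  have f: "(point \<sigma> r + of_real t * w - c) \<bullet> n \<sigma> = t * (w \<bullet> n \<sigma>)"
    "(point \<sigma> r + of_real t * w - c) \<bullet> n (\<not> \<sigma>) = r * sin (2 * \<phi>) + t * (w \<bullet> n (\<not> \<sigma>))"
    using point_inner_normal[of \<sigma> r]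
    by (simp_all add: inner_diff_left inner_add_left scaleR_conv_of_real[symmetric])
  have "(point \<sigma> r + of_real t * w - c) \<bullet> n (\<not> \<sigma>) = 0"
    using assms unfolding f(2) by (simp add: t_def v)
  moreover have "t * (w \<bullet> n \<sigma>) / sin (2 * \<phi>) = r'"
    using sin_pos by (simp add: t_def r'_def)
  ultimately have hit: "point \<sigma> r + of_real t * w = point (\<not> \<sigma>) r'"
    using point_eqI[of "point \<sigma> r + of_real t * w" "\<not> \<sigma>"] by (simp only: not_not f(1))
  have times: "hit_times \<gamma> R c \<alpha> \<phi> ((x, point \<sigma> r), (u, w)) = {t}"
    using hit_times_point[OF assms(1,2)] assms(3) by (simp add: t_def v)
  have "0 < r'"
    using assms by (simp add: r'_def v divide_pos_neg)
  then have "T ((x, point \<sigma> r), v) =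
      (((x + t * u) rmod (2 * pi * \<gamma> * R), point (\<not> \<sigma>) r'), half_turn (axis (\<not> \<sigma>)) v)"
    using hit times by (simp add: billiard_map_def Let_def flight_def v collision_point)
  with that rmod_circle show ?thesis
    by (auto simp: r'_def v)
qed

section \<open>Iterates of the billiard map as products of half-turns\<close>

definition side :: "bool \<Rightarrow> nat \<Rightarrow> bool" where
  "side \<sigma> k = (\<sigma> = even k)"

lemma side_simps [simp]: "side \<sigma> 0 = \<sigma>" "side \<sigma> (Suc k) = (\<not> side \<sigma> k)"
  by (auto simp: side_def)

text \<open>The velocity after \<open>k\<close> collisions if the orbit lasts that long, but defined
  by the half-turns alone for every \<open>v\<close>. Since \<open>v\<close> already leaves side
  \<open>\<sigma>\<close>, the first half-turn belongs to the opposite side.\<close>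

primrec vel :: "bool \<Rightarrow> nat \<Rightarrow> velocity \<Rightarrow> velocity" where
  "vel \<sigma> 0 v = v"
| "vel \<sigma> (Suc k) v = half_turn (axis (side \<sigma> (Suc k))) (vel \<sigma> k v)"

lemma norm_vel: "norm (vel \<sigma> k v) = norm v"
  by (induction k) (simp_all add: norm_half_turn norm_axis)

lemma vel_even: "vel \<sigma> (2 * m) v = ((half_turn (axis \<sigma>) \<circ> half_turn (axis (\<not> \<sigma>))) ^^ m) v"
  by (induction m) (simp_all add: side_def)

lemma vel_Suc_normal:
  "snd (vel \<sigma> (Suc k) v) \<bullet> n (side \<sigma> (Suc k)) = - (snd (vel \<sigma> k v) \<bullet> n (\<not> side \<sigma> k))"
  by (simp add: half_turn_axis_normal)

text \<open>A collision reverses the normal component of the velocity, so the product of this component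
  with the distance from the vertex is the same at all collisions.\<close>

lemma funpow_billiard_map:
  assumes "0 < r" "x \<in> circle" "\<And>j. j \<le> k \<Longrightarrow> 0 < snd (vel \<sigma> j v) \<bullet> n (side \<sigma> j)"
  shows "\<exists>x'\<in>circle. (T ^^ k) ((x, point \<sigma> r), v) =
    ((x', point (side \<sigma> k) (r * (snd v \<bullet> n \<sigma>) / (snd (vel \<sigma> k v) \<bullet> n (side \<sigma> k)))), vel \<sigma> k v)"
  using assms(3)
proof (induction k)
  case 0
  then show ?case using assms(2) by force
next
  case (Suc k)
  define s where "s = r * (snd v \<bullet> n \<sigma>) / (snd (vel \<sigma> k v) \<bullet> n (side \<sigma> k))"
  obtain x' where x': "(T ^^ k) ((x, point \<sigma> r), v) = ((x', point (side \<sigma> k) s), vel \<sigma> k v)"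
    using Suc by (auto simp: s_def)
  \<comment> \<open>Positivity after the next collision says that the present flight approaches the
    opposite side, since a collision reverses the normal component.\<close>
  have pos: "0 < snd (vel \<sigma> k v) \<bullet> n (side \<sigma> k)" "snd (vel \<sigma> k v) \<bullet> n (\<not> side \<sigma> k) < 0"
    using Suc.prems[of k] Suc.prems[of "Suc k"] unfolding vel_Suc_normal by simp_all
  have "0 < s"
    using assms(1) pos(1) Suc.prems[of 0] by (simp add: s_def)
  then obtain x'' where "x'' \<in> circle"
    "T ((x', point (side \<sigma> k) s), vel \<sigma> k v) = ((x'', point (\<not> side \<sigma> k)
      (s * (snd (vel \<sigma> k v) \<bullet> n (side \<sigma> k)) / (- (snd (vel \<sigma> k v) \<bullet> n (\<not> side \<sigma> k))))), vel \<sigma> (Suc k) v)"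
    using billiard_map_point[of s "vel \<sigma> k v" "side \<sigma> k" x'] pos by auto
  moreover have "s * (snd (vel \<sigma> k v) \<bullet> n (side \<sigma> k)) = r * (snd v \<bullet> n \<sigma>)"
    using pos(1) by (simp add: s_def)
  ultimately show ?case
    unfolding vel_Suc_normal using x' by auto
qed

text \<open>An orbit can only break off at a flight that does not approach the opposite side; no
  flight runs into the corner. Completeness thus becomes a sequence of linear inequalities on
  \<open>v\<close>.\<close>

lemma complete_orbit_iff:
  assumes "0 < r" "x \<in> circle" "norm v = 1" "0 < snd v \<bullet> n \<sigma>"
  shows "complete_orbit \<gamma> R c \<alpha> \<phi> ((x, point \<sigma> r), v) \<longleftrightarrow>
    (\<forall>k. 0 < snd (vel \<sigma> k v) \<bullet> n (side \<sigma> k))"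
proof
  assume pos: "\<forall>k. 0 < snd (vel \<sigma> k v) \<bullet> n (side \<sigma> k)"
  define s where "s k = r * (snd v \<bullet> n \<sigma>) / (snd (vel \<sigma> k v) \<bullet> n (side \<sigma> k))" for k
  have s: "0 < s k" for k
    using assms pos by (simp add: s_def)
  have it: "\<exists>x'\<in>circle. (T ^^ k) ((x, point \<sigma> r), v) = ((x', point (side \<sigma> k) (s k)), vel \<sigma> k v)" for k
    using funpow_billiard_map[OF assms(1,2)] pos unfolding s_def by blast
  have ps: "(T ^^ k) ((x, point \<sigma> r), v) \<in> phase_space \<gamma> R c \<alpha> \<phi>" for k
  proof -
    obtain x' where "x' \<in> circle" "(T ^^ k) ((x, point \<sigma> r), v) = ((x', point (side \<sigma> k) (s k)), vel \<sigma> k v)"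
      using it by blast
    moreover have "norm (vel \<sigma> k v) = 1"
      using assms by (simp add: norm_vel)
    ultimately show ?thesis
      using s pos by (metis phase_space_iff)
  qed
  have "hit_times \<gamma> R c \<alpha> \<phi> ((T ^^ k) ((x, point \<sigma> r), v)) \<noteq> {}" for k
  proof -
    have "snd (vel \<sigma> k v) \<bullet> n (\<not> side \<sigma> k) < 0"
      using pos[rule_format, of "Suc k"] unfolding vel_Suc_normal by simp
    then show ?thesis
      using it[of k] pos s by (auto simp: hit_times_point)
  qed
  then show "complete_orbit \<gamma> R c \<alpha> \<phi> ((x, point \<sigma> r), v)"
    using ps ps[of "Suc _"] by (simp add: complete_orbit_def billiard_domain_def)
next
  assume co: "complete_orbit \<gamma> R c \<alpha> \<phi> ((x, point \<sigma> r), v)"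
  \<comment> \<open>The explicit form of an iterate is available only while all earlier signs are
    positive, so these are carried through the induction.\<close>
  have "\<forall>j\<le>k. 0 < snd (vel \<sigma> j v) \<bullet> n (side \<sigma> j)" for k
  proof (induction k)
    case 0
    then show ?case using assms by simp
  next
    case (Suc k)
    define s where "s = r * (snd v \<bullet> n \<sigma>) / (snd (vel \<sigma> k v) \<bullet> n (side \<sigma> k))"
    have pos: "0 < snd (vel \<sigma> k v) \<bullet> n (side \<sigma> k)"
      using Suc by simp
    then have "0 < s"
      using assms by (simp add: s_def)
    obtain x' where "(T ^^ k) ((x, point \<sigma> r), v) = ((x', point (side \<sigma> k) s), vel \<sigma> k v)"
      using funpow_billiard_map[OF assms(1,2)] Suc unfolding s_def by blast
    moreover have "hit_times \<gamma> R c \<alpha> \<phi> ((T ^^ k) ((x, point \<sigma> r), v)) \<noteq> {}"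
      using co by (simp add: complete_orbit_def billiard_domain_def)
    ultimately have "snd (vel \<sigma> k v) \<bullet> n (\<not> side \<sigma> k) < 0"
      using hit_times_point[OF \<open>0 < s\<close> pos] by (simp split: if_splits)
    then have "0 < snd (vel \<sigma> (Suc k) v) \<bullet> n (side \<sigma> (Suc k))"
      unfolding vel_Suc_normal by simp
    then show ?case
      using Suc le_Suc_eq by blast
  qed
  then show "\<forall>k. 0 < snd (vel \<sigma> k v) \<bullet> n (side \<sigma> k)" by blast
qed

section \<open>Periodicity in the reduced phase space\<close>

text \<open>Sides alternate, so a period is even. Once the velocity recurs on the same side, the
  conserved product of normal velocity and distance from the vertex makes the position recur as
  well.\<close>

lemma has_period_iff:
  assumes "0 < r" "x \<in> circle" "norm v = 1" "0 < snd v \<bullet> n \<sigma>"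
    and co: "complete_orbit \<gamma> R c \<alpha> \<phi> ((x, point \<sigma> r), v)"
  shows "has_period \<gamma> R c \<alpha> \<phi> k ((x, point \<sigma> r), v) \<longleftrightarrow> 0 < k \<and> even k \<and> vel \<sigma> k v = v"
proof -
  have pos: "0 < snd (vel \<sigma> j v) \<bullet> n (side \<sigma> j)" for j
    using co complete_orbit_iff[OF assms(1-4)] by blast
  obtain x' where it: "(T ^^ k) ((x, point \<sigma> r), v) =
    ((x', point (side \<sigma> k) (r * (snd v \<bullet> n \<sigma>) / (snd (vel \<sigma> k v) \<bullet> n (side \<sigma> k)))), vel \<sigma> k v)"
    using funpow_billiard_map[OF assms(1,2)] pos by blast
  have "point (side \<sigma> k) s = point \<sigma> r \<longleftrightarrow> even k \<and> s = r" for s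
    using point_eq_iff[OF assms(1), of \<sigma> "side \<sigma> k" s] by (auto simp: side_def)
  moreover have "r * (snd v \<bullet> n \<sigma>) / (snd (vel \<sigma> k v) \<bullet> n (side \<sigma> k)) = r"
    if "even k" "vel \<sigma> k v = v"
  proof -
    have "side \<sigma> k = \<sigma>"
      using that(1) by (simp add: side_def)
    then show ?thesis
      using that(2) assms(4) by simp
  qed
  ultimately show ?thesis
    unfolding has_period_def reduced_def it fst_conv snd_conv prod.inject using co by blast
qed

lemma complete_orbit_cases:
  assumes "complete_orbit \<gamma> R c \<alpha> \<phi> z"
  obtains x \<sigma> r v where "z = ((x, point \<sigma> r), v)"
    "0 < r" "x \<in> circle" "norm v = 1" "0 < snd v \<bullet> n \<sigma>"
proof -
  have "(T ^^ 0) z \<in> billiard_domain \<gamma> R c \<alpha> \<phi>"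
    using assms unfolding complete_orbit_def by blast
  then have "z \<in> phase_space \<gamma> R c \<alpha> \<phi>"
    by (simp add: billiard_domain_def)
  then show ?thesis
    using that by (metis phase_space_iff surj_pair)
qed

text \<open>The 2q collisions form q pairs, each the product of the two half-turns. The inner
  product of the axes is symmetric, so either starting side is covered.\<close>

lemma has_period_of_angle:
  assumes "complete_orbit \<gamma> R c \<alpha> \<phi> z" "0 < q"
    and "axis True \<bullet> axis False = cos \<delta>" "cos (2 * real q * \<delta>) = 1"
  shows "has_period \<gamma> R c \<alpha> \<phi> (2 * q) z"
proof -
  obtain x \<sigma> r v where z: "z = ((x, point \<sigma> r), v)"
    and *: "0 < r" "x \<in> circle" "norm v = 1" "0 < snd v \<bullet> n \<sigma>"
    using complete_orbit_cases[OF assms(1)] .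
  have "axis \<sigma> \<bullet> axis (\<not> \<sigma>) = cos \<delta>"
    using assms(3) by (cases \<sigma>) (simp_all add: inner_commute)
  then have "vel \<sigma> (2 * q) v = v"
    unfolding vel_even by (rule half_turn_comp_funpow_eq_id[OF norm_axis norm_axis _ assms(4)])
  then show ?thesis
    using has_period_iff[OF *] assms(1,2) by (simp add: z)
qed

text \<open>Up to a positive factor, the cross product of \<open>axis False\<close> and
  \<open>axis True\<close>. It points into the wedge from the side \<open>False\<close> and is not
  normalized.\<close>

definition common_normal :: velocity where
  "common_normal = (- cos (arctan \<gamma>) * sin \<phi>, of_real (sin (arctan \<gamma>)) * (\<i> * cis \<alpha>))"

lemma common_normal_inner_axis: "common_normal \<bullet> axis \<sigma> = 0"
proof -
  have eq: "\<alpha> - (\<alpha> - \<phi>) = \<phi>" "(\<alpha> + \<phi>) - \<alpha> = \<phi>" by simp_all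
  have "(\<i> * cis \<alpha>) \<bullet> (- \<i> * n \<sigma>) = - sin \<phi>"
    using sin_diff[of \<alpha> "\<alpha> - \<phi>"] sin_diff[of "\<alpha> + \<phi>" \<alpha>] unfolding eq
    by (cases \<sigma>) (simp_all add: side_normal_def inner_complex_def algebra_simps)
  then show ?thesis
    by (simp add: common_normal_def axis_def scaleR_conv_of_real[symmetric])
qed

text \<open>Opposite signs on the two sides compensate the reversal at each collision: started on
  the side \<open>False\<close>, motion along this vector points inward after every
  collision.\<close>

lemma common_normal_inner_normal:
  "snd common_normal \<bullet> n \<sigma> = (if \<sigma> then - 1 else 1) * (sin (arctan \<gamma>) * cos \<phi>)"
proof -
  have eq: "\<alpha> - (\<alpha> - \<phi>) = \<phi>" "(\<alpha> + \<phi>) - \<alpha> = \<phi>" by simp_all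
  have "(\<i> * cis \<alpha>) \<bullet> n \<sigma> = (if \<sigma> then - 1 else 1) * cos \<phi>"
    using cos_diff[of \<alpha> "\<alpha> - \<phi>"] cos_diff[of "\<alpha> + \<phi>" \<alpha>] unfolding eq
    by (cases \<sigma>) (simp_all add: side_normal_def inner_complex_def algebra_simps)
  then show ?thesis
    by (simp add: common_normal_def scaleR_conv_of_real[symmetric])
qed

text \<open>Half-turns are linear and negate what is orthogonal to their axes, so the two parts
  evolve separately.\<close>

lemma vel_common_normal_add:
  "vel \<sigma> k (a *\<^sub>R common_normal + w) = ((- 1) ^ k * a) *\<^sub>R common_normal + vel \<sigma> k w"
  by (induction k)
    (simp_all add: half_turn_add half_turn_scaleR half_turn_orthogonal common_normal_inner_axis)

text \<open>At every collision the first part contributes the same positive normal velocity, while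
  the second part keeps its norm and by Cauchy-Schwarz cannot outweigh it.\<close>

lemma complete_orbit_near_common_normal:
  assumes v: "v = a *\<^sub>R common_normal + w" "norm v = 1" and w: "norm w < a * (sin (arctan \<gamma>) * cos \<phi>)"
  shows "complete_orbit \<gamma> R c \<alpha> \<phi> ((0, point False 1), v)" "0 < snd v \<bullet> n False"
proof -
  have pos: "0 < snd (vel False k v) \<bullet> n (side False k)" for k
  proof -
    have "snd (vel False k v) \<bullet> n (side False k) =
        (- 1) ^ k * a * (snd common_normal \<bullet> n (side False k)) + snd (vel False k w) \<bullet> n (side False k)"
      by (simp add: v(1) vel_common_normal_add inner_add_left)
    also have "(- 1) ^ k * a * (snd common_normal \<bullet> n (side False k)) = a * (sin (arctan \<gamma>) * cos \<phi>)"
      by (simp add: common_normal_inner_normal side_def)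
    finally show ?thesis
      using w inner_normal_bound[of "vel False k w" "side False k"] by (simp add: norm_vel)
  qed
  from pos[of 0] show *: "0 < snd v \<bullet> n False" by simp
  have "0 \<in> circle" using \<gamma>_pos R_pos by simp
  then show "complete_orbit \<gamma> R c \<alpha> \<phi> ((0, point False 1), v)"
    using complete_orbit_iff[of 1 0 v False] pos * v(2) by simp
qed

lemma sin_arctan_cos_pos: "0 < sin (arctan \<gamma>) * cos \<phi>"
proof (rule mult_pos_pos)
  show "0 < sin (arctan \<gamma>)"
    using \<gamma>_pos by (simp add: sin_arctan add_pos_nonneg)
  show "0 < cos \<phi>"
    using \<phi>_pos \<phi>_less by (rule cos_gt_zero)
qed

text \<open>Motion along the common normal is reversed by each of two collisions, and period 1 is
  excluded because it is odd.\<close>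

lemma ex_has_least_period_two: "\<exists>z. has_least_period \<gamma> R c \<alpha> \<phi> 2 z"
proof -
  have "common_normal \<noteq> 0"
    using common_normal_inner_normal[of False] sin_arctan_cos_pos by auto
  then obtain a where a: "0 < a" "norm (a *\<^sub>R common_normal) = 1"
    using that[of "1 / norm common_normal"] by simp
  define v where "v = a *\<^sub>R common_normal + 0"
  have v: "norm v = 1" "norm (0 :: velocity) < a * (sin (arctan \<gamma>) * cos \<phi>)"
    using a sin_arctan_cos_pos by (simp_all add: v_def)
  note co = complete_orbit_near_common_normal[OF v_def v]
  have "0 \<in> circle" using \<gamma>_pos R_pos by simp
  note iff = has_period_iff[OF zero_less_one this v(1) co(2,1)]
  have "vel False 2 v = v"
    using half_turn_orthogonal[OF common_normal_inner_axis]
    by (simp add: numeral_2_eq_2 v_def half_turn_scaleR half_turn_orthogonal common_normal_inner_axis)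
  then have "has_least_period \<gamma> R c \<alpha> \<phi> 2 ((0, point False 1), v)"
    unfolding has_least_period_def iff by (auto simp: less_2_cases_iff)
  then show ?thesis by blast
qed

text \<open>A small component along \<open>axis False\<close> added to the common normal keeps the
  orbit complete. Each pair of collisions rotates it by 2\<pi>/q in the plane of the axes, so it
  first returns after q pairs.\<close>

lemma ex_has_least_period:
  assumes "2 \<le> q" and angle: "axis False \<bullet> axis True = cos (pi / real q)"
  shows "\<exists>z. has_least_period \<gamma> R c \<alpha> \<phi> (2 * q) z"
proof -
  define \<delta> where "\<delta> = pi / real q"
  \<comment> \<open>Half the admissible size: small enough for completeness, yet nonzero so that the
    rotation acts visibly.\<close>
  define \<epsilon> where "\<epsilon> = sin (arctan \<gamma>) * cos \<phi> / 2"
  have \<epsilon>: "0 < \<epsilon>" "\<epsilon> < sin (arctan \<gamma>) * cos \<phi>"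
    using sin_arctan_cos_pos unfolding \<epsilon>_def by linarith+
  have u: "axis False \<bullet> axis False = 1"
    using norm_axis by (simp add: norm_eq_1)
  have "0 < \<delta>" "\<delta> < pi"
    using assms(1) by (simp_all add: \<delta>_def field_simps)
  then have sin: "sin \<delta> \<noteq> 0"
    using sin_gt_zero by force
  obtain p where p: "p \<bullet> axis False = 0" "axis True = cos \<delta> *\<^sub>R axis False + sin \<delta> *\<^sub>R p"
    "\<And>m v. ((half_turn (axis False) \<circ> half_turn (axis True)) ^^ m) v =
       plane_rotation (axis False) p (2 * real m * \<delta>) v"
    and pp: "p \<bullet> p = 1"
    using half_turn_comp_funpow[OF norm_axis norm_axis angle[folded \<delta>_def] sin] by metis
  have "(common_normal + \<epsilon> *\<^sub>R axis False) \<bullet> axis False \<noteq> 0"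
    using \<epsilon> u by (simp add: inner_add_left common_normal_inner_axis)
  then have "common_normal + \<epsilon> *\<^sub>R axis False \<noteq> 0"
    by auto
  then obtain a where a: "0 < a" "norm (a *\<^sub>R (common_normal + \<epsilon> *\<^sub>R axis False)) = 1"
    using that[of "1 / norm (common_normal + \<epsilon> *\<^sub>R axis False)"] by simp
  define v where "v = a *\<^sub>R common_normal + (a * \<epsilon>) *\<^sub>R axis False"
  have v: "norm v = 1" "norm ((a * \<epsilon>) *\<^sub>R axis False) < a * (sin (arctan \<gamma>) * cos \<phi>)"
    using a \<epsilon> by (simp_all add: v_def scaleR_add_right norm_axis)
  note co = complete_orbit_near_common_normal[OF v_def v]
  have "0 \<in> circle" using \<gamma>_pos R_pos by simp
  note iff = has_period_iff[OF zero_less_one this v(1) co(2,1)]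
  \<comment> \<open>Being orthogonal to both axes, the common normal is orthogonal to
    \<open>p\<close>. Within the plane of rotation \<open>v\<close> thus has only a component along
    \<open>axis False\<close>, whose return forces the cosine of the total angle to be 1.\<close>
  have "common_normal \<bullet> axis True = sin \<delta> * (common_normal \<bullet> p)"
    unfolding p(2) by (simp add: inner_add_right common_normal_inner_axis)
  then have "common_normal \<bullet> p = 0"
    using sin by (simp add: common_normal_inner_axis)
  then have vp: "v \<bullet> p = 0" and vu: "v \<bullet> axis False \<noteq> 0"
    using p(1) a \<epsilon> u
    by (simp_all add: v_def inner_add_left common_normal_inner_axis inner_commute[of "axis False" p])
  have cos1: "cos (2 * real m * \<delta>) = 1" if "vel False (2 * m) v = v" for m
  proof -
    have "plane_rotation (axis False) p (2 * real m * \<delta>) v \<bullet> axis False = v \<bullet> axis False"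
      using that by (simp add: vel_even p(3))
    then show ?thesis
      using vp vu plane_rotation_inner(1)[OF u pp, of "2 * real m * \<delta>" v] p(1)
      by (simp add: inner_commute[of "axis False" p])
  qed
  have "\<not> has_period \<gamma> R c \<alpha> \<phi> k ((0, point False 1), v)" if k: "k < 2 * q" for k
  proof
    assume "has_period \<gamma> R c \<alpha> \<phi> k ((0, point False 1), v)"
    then obtain m where m: "0 < m" "m < q" "vel False (2 * m) v = v"
      using k unfolding iff by (auto elim!: evenE)
    \<comment> \<open>The total angle is a multiple of 2\<pi>, so q divides m, which is impossible
      for 0 < m < q.\<close>
    then obtain i :: int where "2 * real m * \<delta> = of_int i * 2 * pi"
      using cos1 cos_one_2pi_int by metis
    then have "real m = of_int i * real q"
      using assms(1) by (simp add: \<delta>_def field_simps)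
    then have "int m = i * int q"
      by (metis of_int_eq_iff of_int_mult of_int_of_nat_eq)
    then have "int q dvd int m" by simp
    then show False
      using m by (simp add: nat_dvd_not_less)
  qed
  moreover have "has_period \<gamma> R c \<alpha> \<phi> (2 * q) ((0, point False 1), v)"
  proof (rule has_period_of_angle[OF co(1)])
    show "axis True \<bullet> axis False = cos \<delta>"
      using angle by (simp add: \<delta>_def inner_commute)
    show "cos (2 * real q * \<delta>) = 1"
      using assms(1) by (simp add: \<delta>_def)
  qed (use assms(1) in simp)
  ultimately show ?thesis
    unfolding has_least_period_def by blast
qed

end

section \<open>The uniform mass distribution\<close>

lemma uniform_gamma_pos: "0 < uniform_gamma"
  by (simp add: uniform_gamma_def)

text \<open>The squared tangent of half the characteristic angle is 1/2, so the squared cosine and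
  sine are 2/3 and 1/3.\<close>

lemma uniform_axis_inner:
  assumes "convex_wedge uniform_gamma R \<phi>"
  shows "convex_wedge.axis uniform_gamma \<alpha> \<phi> \<sigma> \<bullet> convex_wedge.axis uniform_gamma \<alpha> \<phi> (\<not> \<sigma>) =
    1 - 4 / 3 * (cos \<phi>)\<^sup>2"
proof -
  have "1 + uniform_gamma\<^sup>2 = 3 / 2"
    by (simp add: uniform_gamma_def power_divide)
  moreover have "(cos (arctan uniform_gamma))\<^sup>2 = 1 / (1 + uniform_gamma\<^sup>2)"
    by (simp add: cos_arctan power_divide)
  ultimately have "(cos (arctan uniform_gamma))\<^sup>2 = 2 / 3"
    by (simp only:) simp
  moreover from this have "(sin (arctan uniform_gamma))\<^sup>2 = 1 / 3"
    by (simp add: sin_squared_eq)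
  ultimately show ?thesis
    unfolding convex_wedge.axis_inner_axis[OF assms] cos_double_cos by (simp add: algebra_simps)
qed

text \<open>By the half-angle formula the inner root is |cos \<theta>| with \<theta> = \<pi>p/q,
  which makes |cos \<theta>| the inner product of the axes. Whichever of \<theta> and \<pi> -
  \<theta> has this cosine, 2q times it is a multiple of 2\<pi>.\<close>

lemma has_period_of_bounded_orbit:
  fixes p q :: nat
  assumes "0 < R" "0 < q" "0 < \<phi>" "\<phi> < pi"
    and cos: "cos \<phi> = sqrt 3 / 2 * sqrt (1 - sqrt ((1 + cos (2 * pi * real p / real q)) / 2))"
    and "bounded_orbit uniform_gamma R c \<alpha> \<phi> z"
  shows "has_period uniform_gamma R c \<alpha> \<phi> (2 * q) z"
proof -
  have co: "complete_orbit uniform_gamma R c \<alpha> \<phi> z"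
    using assms by (simp add: bounded_orbit_def)
  define \<theta> where "\<theta> = pi * real p / real q"
  have "(1 + cos (2 * pi * real p / real q)) / 2 = (cos \<theta>)\<^sup>2"
    using cos_double_cos[of \<theta>] by (simp add: \<theta>_def mult.assoc)
  then have cos_\<phi>: "cos \<phi> = sqrt 3 / 2 * sqrt (1 - \<bar>cos \<theta>\<bar>)"
    using cos by simp
  \<comment> \<open>A nonnegative cosine bounds \<phi> by \<pi>/2, and the half-plane carries no
    complete orbit; so the half-angle is acute.\<close>
  have "0 \<le> cos \<phi>"
    by (simp add: cos_\<phi>)
  then have "\<phi> \<le> pi / 2"
    using assms(4) cos_lt_zero_pi[of \<phi>] by (cases "\<phi> \<le> pi / 2") (auto simp: not_le)
  moreover have "\<phi> \<noteq> pi / 2"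
    using no_complete_orbit_half_plane co by blast
  ultimately interpret convex_wedge uniform_gamma R c \<alpha> \<phi>
    using assms uniform_gamma_pos by unfold_locales auto
  have "(cos \<phi>)\<^sup>2 = 3 / 4 * (1 - \<bar>cos \<theta>\<bar>)"
    by (simp add: cos_\<phi> power_mult_distrib power_divide)
  then have inner: "axis True \<bullet> axis False = \<bar>cos \<theta>\<bar>"
    using uniform_axis_inner[OF convex_wedge_axioms, of \<alpha> True] by simp
  have "2 * real q * \<theta> = 2 * real p * pi" "2 * real q * (pi - \<theta>) = 2 * real q * pi - 2 * real p * pi"
    using assms(2) by (simp_all add: \<theta>_def field_simps)
  then have "cos (2 * real q * \<theta>) = 1" "cos (2 * real q * (pi - \<theta>)) = 1"
    by (simp_all only: cos_diff cos_2npi sin_2npi)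
  moreover have "axis True \<bullet> axis False = cos \<theta> \<or> axis True \<bullet> axis False = cos (pi - \<theta>)"
    using inner by (simp add: abs_if)
  ultimately show ?thesis
    using has_period_of_angle[OF co assms(2)] by blast
qed

lemma ex_wedge_has_least_period:
  assumes "0 < R" "0 < q"
  shows "\<exists>\<phi>. 0 < \<phi> \<and> \<phi> < pi \<and> (\<exists>z. has_least_period uniform_gamma R 0 0 \<phi> (2 * q) z)"
proof (cases "q = 1")
  case True
  \<comment> \<open>Every acute half-angle has an orbit of period 2; \<pi>/4 is an arbitrary
    choice.\<close>
  interpret convex_wedge uniform_gamma R 0 0 "pi / 4"
    using assms uniform_gamma_pos by unfold_locales auto
  show ?thesis
    using ex_has_least_period_two True by (intro exI[of _ "pi / 4"]) simp
next
  case False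
  then have q: "2 \<le> q" using assms by simp
  \<comment> \<open>The solution of 1 - 4/3 x^2 = cos(\<pi>/q), which is the cosine of the angle in
    the theorem for p = 1. For q at least 2 the right-hand side lies in [0, 1), so \<phi> is
    acute.\<close>
  define x where "x = sqrt (3 / 4 * (1 - cos (pi / real q)))"
  have "0 < pi / real q" "pi / real q \<le> pi / 2"
    using q by (simp_all add: field_simps)
  moreover from this have "pi / real q \<le> pi" by linarith
  ultimately have c: "0 \<le> cos (pi / real q)" "cos (pi / real q) < 1"
    using cos_ge_zero[of "pi / real q"] cos_monotone_0_pi[of 0 "pi / real q"] unfolding cos_zero
    by linarith+
  then have x: "0 < x" "x < 1"
    by (simp_all add: x_def)
  define \<phi> where "\<phi> = arccos x"
  have cos: "cos \<phi> = x"
    using x by (simp add: \<phi>_def)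
  have \<phi>: "0 < \<phi>" "\<phi> < pi / 2"
    using x arccos_less_arccos[of x 1] arccos_less_arccos[of 0 x] by (simp_all add: \<phi>_def)
  interpret convex_wedge uniform_gamma R 0 0 \<phi>
    using assms uniform_gamma_pos \<phi> by unfold_locales auto
  have "axis False \<bullet> axis True = cos (pi / real q)"
    using uniform_axis_inner[OF convex_wedge_axioms, of 0 False] c by (simp add: cos x_def field_simps)
  then show ?thesis
    using ex_has_least_period[OF q] \<phi> by (intro exI[of _ \<phi>]) auto
qed

theorem theorem8p2:
  fixes R :: real
  assumes "R > 0"
  shows "(\<forall>n::nat. 0 < n \<and> even n \<longrightarrow>
            (\<exists>c \<alpha> \<phi>. 0 < \<phi> \<and> \<phi> < pi \<and>
               (\<exists>z. has_least_period uniform_gamma R c \<alpha> \<phi> n z))) \<and>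
         (\<forall>(p::nat) (q::nat) c \<alpha> \<phi>. 0 < p \<and> 0 < q \<and> 0 < \<phi> \<and> \<phi> < pi \<and>
            cos \<phi> = sqrt 3 / 2 * sqrt (1 - sqrt ((1 + cos (2 * pi * real p / real q)) / 2)) \<longrightarrow>
            (\<forall>z. bounded_orbit uniform_gamma R c \<alpha> \<phi> z \<longrightarrow>
               has_period uniform_gamma R c \<alpha> \<phi> (2 * q) z))"
proof (intro conjI allI impI)
  fix n :: nat
  assume "0 < n \<and> even n"
  then obtain q where "n = 2 * q" "0 < q" by (auto elim: evenE)
  then show "\<exists>c \<alpha> \<phi>. 0 < \<phi> \<and> \<phi> < pi \<and> (\<exists>z. has_least_period uniform_gamma R c \<alpha> \<phi> n z)"
    using ex_wedge_has_least_period[OF assms] by blast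
next
  fix p q :: nat and c \<alpha> \<phi> z
  assume "0 < p \<and> 0 < q \<and> 0 < \<phi> \<and> \<phi> < pi \<and>
    cos \<phi> = sqrt 3 / 2 * sqrt (1 - sqrt ((1 + cos (2 * pi * real p / real q)) / 2))"
    and "bounded_orbit uniform_gamma R c \<alpha> \<phi> z"
  then show "has_period uniform_gamma R c \<alpha> \<phi> (2 * q) z"
    using has_period_of_bounded_orbit[OF assms] by blast
qed

end
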